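(* For the complete graph $K_n$ with $n\ge 4$, $$b_t^2(K_n)=2n-4.$$
   Context: $K_n$ is the complete graph on $n$ vertices; $\gamma_t(K_n)=2$. A total dominating set of a graph without isolated vertices is a vertex set $S$ such that every vertex is adjacent to some vertex of $S$; $\gamma_t(G)$ is the minimum size of such a set. The $k$-total bondage number $b_t^k(G)$ is the minimum number of edges that must be deleted from $G$ so that the resulting graph (required to have no isolated vertices) has total domination number at least $\gamma_t(G)+k$. *)

theory Defs
  imports "HOL-Library.Ramsey" "HOL-Library.Extended_Nat"
begin

text \<open>
  A finite simple graph is given by a finite vertex set \<open>V\<close> and an edge set
  \<open>E \<subseteq> [V]\<^bsup>2\<^esup>\<close> of two-element subsets of \<open>V\<close>; the complete graph on \<open>V\<close>
  is \<open>E = [V]\<^bsup>2\<^esup>\<close>.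
\<close>

definition adjacent :: "'a set set \<Rightarrow> 'a \<Rightarrow> 'a \<Rightarrow> bool" where
  "adjacent E u v \<longleftrightarrow> u \<noteq> v \<and> {u, v} \<in> E"

definition no_isolated_vertices :: "'a set \<Rightarrow> 'a set set \<Rightarrow> bool" where
  "no_isolated_vertices V E \<longleftrightarrow> (\<forall>v\<in>V. \<exists>u\<in>V. adjacent E u v)"

definition total_dominating_set :: "'a set \<Rightarrow> 'a set set \<Rightarrow> 'a set \<Rightarrow> bool" where
  "total_dominating_set V E S \<longleftrightarrow> S \<subseteq> V \<and> (\<forall>v\<in>V. \<exists>u\<in>S. adjacent E u v)"

text \<open>
  Both numbers below are minima, taken in \<^typ>\<open>enat\<close> so that they are \<open>\<infinity>\<close>
  (rather than an arbitrary natural number) when no admissible set exists.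
\<close>

definition total_domination_number :: "'a set \<Rightarrow> 'a set set \<Rightarrow> enat" where
  "total_domination_number V E =
     (INF S\<in>{S. total_dominating_set V E S}. enat (card S))"

definition total_bondage_number :: "nat \<Rightarrow> 'a set \<Rightarrow> 'a set set \<Rightarrow> enat" where
  "total_bondage_number k V E =
     (INF F\<in>{F. F \<subseteq> E \<and> no_isolated_vertices V (E - F) \<and>
                total_domination_number V (E - F) \<ge> total_domination_number V E + enat k}.
        enat (card F))"

end

theory Submission
  imports Defs
begin

text \<open>
  Deleting all edges between a pair of vertices and the other \<open>n - 2\<close> vertices leaves
  \<open>K\<^sub>2 \<union> K\<^bsub>n-2\<^esub>\<close>, whose total domination number is 4.

  Conversely, let \<open>F\<close> be a set of deleted edges such that the remaining graph \<open>G\<close> has no isolated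
  vertices and no total dominating set with at most three vertices; then any three vertices that
  induce a connected subgraph of \<open>G\<close> have a common \<open>F\<close>-neighbour. Let \<open>v\<close> have minimum \<open>F\<close>-degree
  \<open>d\<close>, let \<open>D\<close> be its set of \<open>F\<close>-neighbours and \<open>A\<close> its set of \<open>G\<close>-neighbours. If some \<open>u \<in> A\<close> had
  only one \<open>F\<close>-neighbour \<open>x \<in> D\<close>, then applying this to the paths \<open>u v w\<close> with \<open>w \<in> A\<close> and
  \<open>v u y\<close> with \<open>y \<in> D\<close> would show that \<open>x\<close> is isolated in \<open>G\<close>. So every vertex of \<open>A\<close> has at least
  two \<open>F\<close>-neighbours in \<open>D\<close>, and \<open>|F| \<ge> d + 2 (n - 1 - d)\<close>, which suffices for \<open>d \<le> 2\<close>. For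
  \<open>d = 3\<close> one further edge is found because all \<open>F\<close>-degrees are at least 3, and for \<open>d \<ge> 4\<close> the
  degree sum is enough.
\<close>

lemma total_dominating_set_card_ge:
  assumes "enat k \<le> total_domination_number V E" "total_dominating_set V E S"
  shows "k \<le> card S"
proof -
  have "total_domination_number V E \<le> enat (card S)"
    unfolding total_domination_number_def using assms(2) by (intro INF_lower) simp
  with assms(1) have "enat k \<le> enat (card S)" by (rule order_trans)
  then show ?thesis by simp
qed

lemma total_domination_number_geI:
  assumes "\<And>S. total_dominating_set V E S \<Longrightarrow> k \<le> card S"
  shows "enat k \<le> total_domination_number V E"
  unfolding total_domination_number_def using assms by (intro INF_greatest) simp

lemma adjacent_sym: "adjacent E u v \<Longrightarrow> adjacent E v u"
  by (simp add: adjacent_def insert_commute eq_commute)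

lemma adjacent_complete_Diff:
  "adjacent ([V]\<^bsup>2\<^esup> - F) u v \<longleftrightarrow> u \<in> V \<and> v \<in> V \<and> u \<noteq> v \<and> {u, v} \<notin> F"
  by (auto simp: adjacent_def nsets_def)

text \<open>Two distinct vertices dominate each other and all the rest, whereas a single vertex
  never dominates itself.\<close>

lemma total_domination_number_complete:
  assumes "finite V" "2 \<le> card V"
  shows "total_domination_number V ([V]\<^bsup>2\<^esup>) = enat 2"
proof (rule antisym)
  obtain a b where ab: "a \<in> V" "b \<in> V" "a \<noteq> b"
    using assms by (auto simp: numeral_2_eq_2 card_le_Suc_iff)
  have "total_dominating_set V ([V]\<^bsup>2\<^esup>) {a, b}"
    using ab adjacent_complete_Diff[of V "{}"] by (auto simp: total_dominating_set_def)
  then have "total_domination_number V ([V]\<^bsup>2\<^esup>) \<le> enat (card {a, b})"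
    unfolding total_domination_number_def by (intro INF_lower) simp
  then show "total_domination_number V ([V]\<^bsup>2\<^esup>) \<le> enat 2"
    using ab by (simp add: numeral_2_eq_2)
  show "enat 2 \<le> total_domination_number V ([V]\<^bsup>2\<^esup>)"
  proof (rule total_domination_number_geI)
    fix S assume S: "total_dominating_set V ([V]\<^bsup>2\<^esup>) S"
    then obtain c where c: "c \<in> S" using ab by (auto simp: total_dominating_set_def)
    with S obtain d where d: "d \<in> S" "d \<noteq> c"
      by (auto simp: total_dominating_set_def adjacent_def)
    have "finite S" using S assms(1) by (auto simp: total_dominating_set_def intro: finite_subset)
    then have "card {c, d} \<le> card S" using c d by (intro card_mono) auto
    then show "2 \<le> card S" using d by simp
  qed
qed

lemma doubleton_inj: "inj_on (\<lambda>x. {a, x}) X"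
  by (auto simp: inj_on_def doubleton_eq_iff)

text \<open>Handshake argument: the degree sum counts each edge of \<open>F\<close> once from either
  endpoint.\<close>

lemma min_degree_le_card_edges:
  assumes "finite V" "F \<subseteq> [V]\<^bsup>2\<^esup>"
    and "\<And>v. v \<in> V \<Longrightarrow> d \<le> card {x \<in> V. {v, x} \<in> F}"
  shows "d * card V \<le> 2 * card F"
proof -
  have fin: "finite F"
    using assms(1,2) finite_imp_finite_nsets finite_subset by metis
  have "d * card V = (\<Sum>v\<in>V. d)" by simp
  also have "\<dots> \<le> (\<Sum>v\<in>V. card {e \<in> F. v \<in> e})"
  proof (rule sum_mono)
    fix v assume "v \<in> V"
    then have "d \<le> card {x \<in> V. {v, x} \<in> F}" by (rule assms(3))
    also have "\<dots> \<le> card {e \<in> F. v \<in> e}"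
      by (rule card_inj_on_le[OF doubleton_inj]) (use fin in auto)
    finally show "d \<le> card {e \<in> F. v \<in> e}" .
  qed
  also have "\<dots> = 2 * card F"
  proof (rule sum_multicount[OF assms(1) fin], rule ballI)
    fix e assume "e \<in> F"
    then have "e \<subseteq> V" "card e = 2" using assms(2) by (auto simp: nsets_def)
    moreover have "{v \<in> V. v \<in> e} = e" using \<open>e \<subseteq> V\<close> by auto
    ultimately show "card {v \<in> V. v \<in> e} = 2" by simp
  qed
  finally show ?thesis .
qed

text \<open>Disjointness of \<open>A\<close> and \<open>D\<close> fixes which endpoint of a crossing
  edge lies where, so such edges correspond to ordered pairs.\<close>

lemma card_crossing_edges:
  assumes "finite A" "finite D" "A \<inter> D = {}"
  shows "card {{u, x} | u x. u \<in> A \<and> x \<in> D \<and> {u, x} \<in> F} = (\<Sum>u\<in>A. card {x \<in> D. {u, x} \<in> F})"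
proof -
  let ?P = "SIGMA u:A. {x \<in> D. {u, x} \<in> F}"
  have "{{u, x} | u x. u \<in> A \<and> x \<in> D \<and> {u, x} \<in> F} = (\<lambda>(u, x). {u, x}) ` ?P"
    by force
  moreover have "inj_on (\<lambda>(u, x). {u, x}) ?P"
    using assms(3) by (auto simp: inj_on_def doubleton_eq_iff)
  ultimately show ?thesis using assms by (simp add: card_image)
qed

text \<open>At most three vertices cannot dominate, so they miss some \<open>x\<close>. Each of
  \<open>u\<close>, \<open>v\<close>, \<open>w\<close> has a neighbour among them, hence
  \<open>x\<close> is a new vertex and its nonadjacency to them means deleted edges. The case
  \<open>u = w\<close> is allowed.\<close>

lemma common_nonneighbour:
  assumes tds: "\<And>S. total_dominating_set V ([V]\<^bsup>2\<^esup> - F) S \<Longrightarrow> 4 \<le> card S"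
    and uv: "adjacent ([V]\<^bsup>2\<^esup> - F) u v" and vw: "adjacent ([V]\<^bsup>2\<^esup> - F) v w"
  obtains x where "x \<in> V" "{u, x} \<in> F" "{v, x} \<in> F" "{w, x} \<in> F"
proof -
  have "card {u, v, w} \<le> 3" by (simp add: card_insert_if)
  then have "\<not> total_dominating_set V ([V]\<^bsup>2\<^esup> - F) {u, v, w}"
    using tds by fastforce
  moreover have "{u, v, w} \<subseteq> V" using uv vw by (auto simp: adjacent_complete_Diff)
  ultimately obtain x where x: "x \<in> V" "\<not> adjacent ([V]\<^bsup>2\<^esup> - F) u x"
    "\<not> adjacent ([V]\<^bsup>2\<^esup> - F) v x" "\<not> adjacent ([V]\<^bsup>2\<^esup> - F) w x"
    by (auto simp: total_dominating_set_def)
  then have "x \<notin> {u, v, w}" using uv vw adjacent_sym by fast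
  then show ?thesis using that x uv vw by (auto simp: adjacent_complete_Diff)
qed

lemma card_deleted_edges_ge:
  assumes "finite V" and F: "F \<subseteq> [V]\<^bsup>2\<^esup>"
    and iso: "no_isolated_vertices V ([V]\<^bsup>2\<^esup> - F)"
    and tds: "\<And>S. total_dominating_set V ([V]\<^bsup>2\<^esup> - F) S \<Longrightarrow> 4 \<le> card S"
  shows "2 * card V - 4 \<le> card F"
proof (cases "V = {}")
  case False
  let ?adj = "adjacent ([V]\<^bsup>2\<^esup> - F)"
  define N where "N u = {x \<in> V. {u, x} \<in> F}" for u
  have fin: "finite F"
    using \<open>finite V\<close> F finite_imp_finite_nsets finite_subset by metis
  have ne: "u \<noteq> x" if "{u, x} \<in> F" for u x
    using that F by (auto simp: nsets_def)
  obtain v where v: "v \<in> V" and min: "\<And>u. u \<in> V \<Longrightarrow> card (N v) \<le> card (N u)"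
    using False ex_has_least_nat[of "\<lambda>u. u \<in> V" _ "\<lambda>u. card (N u)"] by blast
  show ?thesis
  proof (cases "4 \<le> card (N v)")
    case True
    then have "4 * card V \<le> 2 * card F"
      using min by (intro min_degree_le_card_edges[OF \<open>finite V\<close> F]) (force simp: N_def)
    then show ?thesis by simp
  next
    case False
    define D where "D = N v"
    define A where "A = V - {v} - D"
    have DV: "D \<subseteq> V" "v \<notin> D" using ne[of v v] by (auto simp: D_def N_def)
    have finD: "finite D" and finA: "finite A" and AD: "A \<inter> D = {}"
      using DV \<open>finite V\<close> by (auto simp: A_def intro: finite_subset)
    have vA: "v \<notin> A" by (simp add: A_def)
    have V_eq: "V = insert v (A \<union> D)" using DV v by (auto simp: A_def)
    have cardV: "card V = Suc (card A + card D)"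
      unfolding V_eq using finA finD AD DV(2) vA by (simp add: card_Un_disjoint)
    have A_iff: "u \<in> A \<longleftrightarrow> ?adj v u" for u
      using v by (auto simp: A_def D_def N_def adjacent_complete_Diff)
    obtain u0 where u0: "u0 \<in> A"
      using iso v A_iff adjacent_sym unfolding no_isolated_vertices_def by metis
    \<comment> \<open>The missed vertex is also an \<open>F\<close>-neighbour of \<open>v\<close>,
      the centre of the path, hence lies in \<open>D\<close>. Taking \<open>u = w\<close> gives
      every \<open>u\<close> in \<open>A\<close> an \<open>F\<close>-neighbour in
      \<open>D\<close>.\<close>
    have pair: "\<exists>x\<in>D. {u, x} \<in> F \<and> {w, x} \<in> F" if "u \<in> A" "w \<in> A" for u w
      using that common_nonneighbour[of V F u v w, OF tds] adjacent_sym A_iff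
      by (metis (no_types, lifting) D_def N_def mem_Collect_eq)
    have path: "\<exists>x\<in>D. {u, x} \<in> F \<and> {y, x} \<in> F" if "u \<in> A" "y \<in> D" "{u, y} \<notin> F" for u y
    proof -
      have "?adj u y" using that DV AD by (auto simp: adjacent_complete_Diff A_def)
      then show ?thesis
        using that common_nonneighbour[of V F v u y, OF tds] A_iff
        by (metis (no_types, lifting) D_def N_def mem_Collect_eq)
    qed
    have two: "2 \<le> card {x \<in> D. {u, x} \<in> F}" if u: "u \<in> A" for u
    proof (rule ccontr)
      assume few: "\<not> ?thesis"
      obtain x where x: "x \<in> D" "{u, x} \<in> F" using pair[OF u u] by blast
      have only: "y = x" if "y \<in> D" "{u, y} \<in> F" for y
      proof (rule ccontr)
        assume "y \<noteq> x"
        then have "2 = card {x, y}" by simp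
        also have "\<dots> \<le> card {x \<in> D. {u, x} \<in> F}" using x that finD by (intro card_mono) auto
        finally show False using few by simp
      qed
      \<comment> \<open>Both \<open>pair\<close> and \<open>path\<close> yield a witness in
        \<open>D\<close> that is an \<open>F\<close>-neighbour of \<open>u\<close>; by
        \<open>only\<close> it must be \<open>x\<close>.\<close>
      have "{w, x} \<in> F" if w: "w \<in> V" "w \<noteq> x" for w
      proof -
        consider "w = v" | "w \<in> A" | "w \<in> D" using w V_eq by blast
        then show ?thesis
        proof cases
          case 1 then show ?thesis using x by (auto simp: D_def N_def)
        next
          case 2 then show ?thesis using pair[OF u 2] only by blast
        next
          case 3
          then have "{u, w} \<notin> F" using only w by blast
          then show ?thesis using path[OF u 3] only by blast
        qed
      qed
      then show False
        using iso x DV unfolding no_isolated_vertices_def adjacent_complete_Diff by blast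
    qed
    \<comment> \<open>The edges of \<open>F\<close> to be counted: the star at \<open>v\<close>, and
      those between \<open>A\<close> and \<open>D\<close>. They are disjoint because
      \<open>v\<close> is in neither set.\<close>
    define S where "S = (\<lambda>x. {v, x}) ` D"
    define C where "C = {{u, x} | u x. u \<in> A \<and> x \<in> D \<and> {u, x} \<in> F}"
    have CS: "C \<subseteq> F" "S \<subseteq> F" by (auto simp: C_def S_def D_def N_def)
    have "S \<inter> C = {}" using DV by (auto simp: C_def S_def A_def doubleton_eq_iff)
    moreover have "finite C" "finite S" using CS fin finite_subset by blast+
    moreover have "card S = card D" unfolding S_def by (rule card_image[OF doubleton_inj])
    ultimately have cardSC: "card (S \<union> C) = card D + (\<Sum>u\<in>A. card {x \<in> D. {u, x} \<in> F})"
      unfolding C_def using card_crossing_edges[OF finA finD AD] by (simp add: card_Un_disjoint)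
    have lower: "card D + k * card A \<le> card (S \<union> C)"
      if "\<And>u. u \<in> A \<Longrightarrow> k \<le> card {x \<in> D. {u, x} \<in> F}" for k
      using sum_mono[of A "\<lambda>_. k" "\<lambda>u. card {x \<in> D. {u, x} \<in> F}"] that cardSC
      by (simp add: mult.commute)
    have le: "card (S \<union> C) \<le> card F" using CS fin by (intro card_mono) auto
    have "card {x \<in> D. {u0, x} \<in> F} \<le> card D" using finD by (intro card_mono) auto
    then have "2 \<le> card D" using two[OF u0] by simp
    then consider "card D = 2" | "card D = 3" using False by (fastforce simp: D_def)
    then show ?thesis
    proof cases
      \<comment> \<open>Here \<open>card V = card A + 3\<close>, so \<open>2 + 2 * card A\<close> is
        exactly the bound.\<close>
      case 1
      then show ?thesis using lower[OF two] le cardV by simp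
    next
      \<comment> \<open>Now \<open>card V = card A + 4\<close>, and \<open>3 + 2 * card A\<close>
        falls short of the bound by one.\<close>
      case 2
      show ?thesis
      proof (cases "\<forall>u\<in>A. 3 \<le> card {x \<in> D. {u, x} \<in> F}")
        case True
        \<comment> \<open>\<open>3 + 3 * card A\<close> reaches \<open>2 * card A + 4\<close> as
          soon as \<open>A\<close> is nonempty.\<close>
        moreover have "card A > 0" using u0 finA by (auto simp: card_gt_0_iff)
        ultimately show ?thesis using lower[of 3] le cardV 2 by auto
      next
        case False
        then obtain u where u: "u \<in> A" "card {x \<in> D. {u, x} \<in> F} < 3" by (auto simp: not_le)
        moreover have "3 \<le> card (N u)" using min[of u] u(1) 2 by (auto simp: D_def A_def)
        moreover have "card (N u) \<le> card {x \<in> D. {u, x} \<in> F}" if "N u \<subseteq> D"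
          using that finD by (intro card_mono) (auto simp: N_def)
        \<comment> \<open>At most two of the at least three \<open>F\<close>-neighbours of
          \<open>u\<close> lie in \<open>D\<close>. Another one, \<open>w\<close>, lies in
          \<open>A\<close>, so the edge \<open>{u, w}\<close> inside \<open>A\<close> is not yet
          counted.\<close>
        ultimately obtain w where w: "w \<in> N u" "w \<notin> D" by fastforce
        have "w \<noteq> v" using w u(1) by (auto simp: N_def A_def D_def insert_commute)
        then have "{u, w} \<notin> S \<union> C" using u(1) w AD
          by (auto simp: S_def C_def A_def doubleton_eq_iff)
        moreover have "{u, w} \<in> F" using w by (simp add: N_def)
        ultimately have "S \<union> C \<subset> F" using CS by blast
        then have "card (S \<union> C) < card F" using fin by (rule psubset_card_mono[rotated])
        then show ?thesis using lower[OF two] cardV 2 by simp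
      qed
    qed
  qed
qed simp

lemma disconnecting_pair:
  assumes "finite V" "4 \<le> card V"
  obtains F where "F \<subseteq> [V]\<^bsup>2\<^esup>" "no_isolated_vertices V ([V]\<^bsup>2\<^esup> - F)"
    "enat 4 \<le> total_domination_number V ([V]\<^bsup>2\<^esup> - F)" "card F \<le> 2 * card V - 4"
proof -
  obtain a b where ab: "a \<in> V" "b \<in> V" "a \<noteq> b"
    using assms by (auto simp: numeral_eq_Suc card_le_Suc_iff)
  define W where "W = V - {a, b}"
  have finW: "finite W" and cardW: "card W = card V - 2"
    using assms(1) ab by (auto simp: W_def card_Diff_subset)
  then have "2 \<le> card W" using assms(2) by simp
  then obtain c c' where c: "c \<in> W" "c' \<in> W" "c \<noteq> c'"
    using finW by (auto simp: numeral_2_eq_2 card_le_Suc_iff)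
  define F where "F = (\<lambda>x. {a, x}) ` W \<union> (\<lambda>x. {b, x}) ` W"
  have F_iff: "{x, y} \<in> F \<longleftrightarrow> x \<in> {a, b} \<and> y \<in> W \<or> x \<in> W \<and> y \<in> {a, b}" for x y
    unfolding F_def image_iff Un_iff doubleton_eq_iff by blast
  have adj: "adjacent ([V]\<^bsup>2\<^esup> - F) x y \<longleftrightarrow>
      x = a \<and> y = b \<or> x = b \<and> y = a \<or> x \<in> W \<and> y \<in> W \<and> x \<noteq> y" for x y
    using ab unfolding adjacent_complete_Diff F_iff W_def by blast
  show ?thesis
  proof
    show "F \<subseteq> [V]\<^bsup>2\<^esup>" using ab by (auto simp: F_def W_def nsets_def)
    show "no_isolated_vertices V ([V]\<^bsup>2\<^esup> - F)"
      unfolding no_isolated_vertices_def adj using ab c by (metis DiffD1 DiffI W_def insertE singletonD)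
    have "card F \<le> card W + card W"
      unfolding F_def using finW by (meson add_mono card_Un_le card_image_le order_trans)
    then show "card F \<le> 2 * card V - 4" using cardW by simp
    show "enat 4 \<le> total_domination_number V ([V]\<^bsup>2\<^esup> - F)"
    proof (rule total_domination_number_geI)
      fix S assume "total_dominating_set V ([V]\<^bsup>2\<^esup> - F) S"
      then have S: "S \<subseteq> V" and dom: "\<And>v. v \<in> V \<Longrightarrow> \<exists>u\<in>S. adjacent ([V]\<^bsup>2\<^esup> - F) u v"
        by (auto simp: total_dominating_set_def)
      have WV: "W \<subseteq> V" "a \<notin> W" "b \<notin> W" by (auto simp: W_def)
      \<comment> \<open>\<open>a\<close> and \<open>b\<close> are each other's only neighbours, so
        both are forced into \<open>S\<close>. In \<open>W\<close>, some \<open>d\<close> must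
        dominate \<open>c\<close>, and a further vertex must dominate \<open>d\<close>.\<close>
      have "a \<in> S" using dom[OF ab(2)] ab WV by (auto simp: adj)
      moreover have "b \<in> S" using dom[OF ab(1)] ab WV by (auto simp: adj)
      moreover obtain d where d: "d \<in> S" "d \<in> W" using dom[of c] c WV by (auto simp: adj)
      moreover obtain e where e: "e \<in> S" "e \<in> W" "e \<noteq> d" using dom[of d] d WV by (auto simp: adj)
      moreover have "finite S" using S assms(1) by (rule finite_subset)
      ultimately have "card {a, b, d, e} \<le> card S" by (intro card_mono) auto
      moreover have "card {a, b, d, e} = 4" using ab d e WV by (auto simp: card_insert_if)
      ultimately show "4 \<le> card S" by simp
    qed
  qed
qed

theorem theorem3p12:
  fixes V :: "'a set" and n :: nat
  assumes "finite V" and "card V = n" and "n \<ge> 4"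
  shows "total_bondage_number 2 V ([V]\<^bsup>2\<^esup>) = enat (2 * n - 4)"
proof (rule antisym)
  \<comment> \<open>This turns the requirement on \<open>F\<close> into total domination number at
    least 4.\<close>
  have K: "total_domination_number V ([V]\<^bsup>2\<^esup>) + enat 2 = enat 4"
    using total_domination_number_complete[OF assms(1)] assms by simp
  obtain F where F: "F \<subseteq> [V]\<^bsup>2\<^esup>" "no_isolated_vertices V ([V]\<^bsup>2\<^esup> - F)"
    "enat 4 \<le> total_domination_number V ([V]\<^bsup>2\<^esup> - F)" "card F \<le> 2 * card V - 4"
    using disconnecting_pair assms by metis
  then have "total_bondage_number 2 V ([V]\<^bsup>2\<^esup>) \<le> enat (card F)"
    unfolding total_bondage_number_def K by (intro INF_lower) simp
  also have "\<dots> \<le> enat (2 * n - 4)" using F(4) assms(2) by simp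
  finally show "total_bondage_number 2 V ([V]\<^bsup>2\<^esup>) \<le> enat (2 * n - 4)" .
  show "enat (2 * n - 4) \<le> total_bondage_number 2 V ([V]\<^bsup>2\<^esup>)"
    unfolding total_bondage_number_def K
  proof (rule INF_greatest)
    fix F assume "F \<in> {F. F \<subseteq> [V]\<^bsup>2\<^esup> \<and> no_isolated_vertices V ([V]\<^bsup>2\<^esup> - F) \<and>
      enat 4 \<le> total_domination_number V ([V]\<^bsup>2\<^esup> - F)}"
    then have "2 * card V - 4 \<le> card F"
      by (intro card_deleted_edges_ge[OF assms(1)] total_dominating_set_card_ge) auto
    then show "enat (2 * n - 4) \<le> enat (card F)" using assms(2) by simp
  qed
qed

end
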